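(* Let $0<\delta<1$, $0<\sigma<1$, $t>0$, $s=\sigma+it$, and define $$S_1(\sigma,t,\delta)=\sum_{m=1}^{[t^{\delta}]}\ \sum_{n=[t^{1-\delta}m]+1}^{[t]+m}\frac{1}{m^{s}n^{\bar s}}.$$ Then, as $t\to\infty$: if $\sigma\neq\frac12$, $$S_1(\sigma,t,\delta)=O\left(t^{\frac12-\sigma}\left(t^{(1-\sigma)\delta}+t^{\sigma\delta}\right)\right)+O\left(\frac{t^{(1-\sigma)\delta}}{t^{\sigma}}\right);$$ and if $\sigma=\frac12$, $$S_1\left(\tfrac12,t,\delta\right)=O\left(t^{\frac{\delta}{2}}\ln t\right)+O\left(\frac{t^{\frac{\delta}{2}}}{t^{\frac12}}\right).$$
   Context: $[A]$ denotes the integer part of $A$, and $\bar s=\sigma-it$ is the complex conjugate of $s$. Sums over empty ranges are zero. The parameters $\sigma,\delta$ are fixed, and the $O$-statements are for real $t\to\infty$ (implied constants may depend on $\sigma,\delta$). *)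

theory Defs
  imports "HOL-Analysis.Analysis" "HOL-Library.Landau_Symbols"
begin

definition S1 :: "real \<Rightarrow> real \<Rightarrow> real \<Rightarrow> complex" where
  "S1 \<sigma> t \<delta> =
     (let s = Complex \<sigma> t in
      \<Sum>m = 1..nat \<lfloor>t powr \<delta>\<rfloor>.
        \<Sum>n = nat \<lfloor>t powr (1 - \<delta>) * real m\<rfloor> + 1..nat \<lfloor>t\<rfloor> + m.
          1 / (of_nat m powr s * of_nat n powr cnj s))"

end

theory Submission
  imports Defs "HOL-Real_Asymp.Real_Asymp"
begin

text \<open>By van der Corput's second derivative test, the sum of \<open>n\<^bsup>it\<^esup>\<close> over any part of a dyadic block
  \<open>(a, 2a]\<close> with \<open>a \<le> 2t\<close> is \<open>O(t\<^bsup>1/2\<^esup>)\<close>. Partial summation and a geometric series over the blocks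
  bound the inner sum, which starts at \<open>x = t\<^bsup>1-\<delta>\<^esup> m\<close>, by \<open>O(t\<^bsup>1/2\<^esup> x\<^bsup>-\<sigma>\<^esup>)\<close>. It remains to sum
  \<open>m\<^bsup>-2\<sigma>\<^esup>\<close> over \<open>m \<le> t\<^bsup>\<delta>\<^esup>\<close>, which is where \<open>\<sigma> = 1/2\<close> produces the logarithm. The first error term
  alone absorbs everything: the second one can be taken to be zero.\<close>

subsection \<open>Partial summation\<close>

lemma sum_by_parts:
  fixes w z :: "nat \<Rightarrow> 'a::ring"
  assumes "a \<le> b"
  shows "(\<Sum>n=a..b. w n * z n)
    = w b * (\<Sum>n=a..b. z n) + (\<Sum>n=a..<b. (w n - w (Suc n)) * (\<Sum>k=a..n. z k))"
  using assms
proof (induction b rule: nat_induct_at_least)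
  case (Suc b)
  then show ?case
    by (simp add: algebra_simps)
qed simp

lemma norm_sum_mult_le_variation:
  fixes w z :: "nat \<Rightarrow> 'a::real_normed_algebra"
  assumes "a \<le> b" and partial: "\<And>c. c \<in> {a..b} \<Longrightarrow> norm (\<Sum>n=a..c. z n) \<le> B"
  shows "norm (\<Sum>n=a..b. w n * z n) \<le> (norm (w b) + (\<Sum>n=a..<b. norm (w n - w (Suc n)))) * B"
proof -
  have "norm (\<Sum>n=a..b. w n * z n) \<le> norm (w b * (\<Sum>n=a..b. z n))
      + norm (\<Sum>n=a..<b. (w n - w (Suc n)) * (\<Sum>k=a..n. z k))"
    unfolding sum_by_parts[OF \<open>a \<le> b\<close>] by (rule norm_triangle_ineq)
  also have "\<dots> \<le> norm (w b) * B + (\<Sum>n=a..<b. norm (w n - w (Suc n)) * B)"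
    using \<open>a \<le> b\<close>
    by (intro add_mono sum_norm_le order_trans[OF norm_mult_ineq] mult_left_mono partial) auto
  finally show ?thesis
    by (simp add: distrib_right sum_distrib_right)
qed

lemma norm_sum_antimono_weights_le:
  fixes w :: "nat \<Rightarrow> real" and z :: "nat \<Rightarrow> 'a::real_normed_algebra_1"
  assumes "a \<le> b" and antimono: "\<And>n. n \<in> {a..<b} \<Longrightarrow> w (Suc n) \<le> w n" and "0 \<le> w b"
    and "\<And>c. c \<in> {a..b} \<Longrightarrow> norm (\<Sum>n=a..c. z n) \<le> B"
  shows "norm (\<Sum>n=a..b. of_real (w n) * z n) \<le> w a * B"
proof -
  have "(\<Sum>n=a..<b. norm (of_real (w n) - of_real (w (Suc n)) :: 'a)) = (\<Sum>n=a..<b. w n - w (Suc n))"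
    using antimono by (intro sum.cong) (auto simp flip: of_real_diff)
  also have "\<dots> = w a - w b"
    using sum_Suc_diff'[OF \<open>a \<le> b\<close>, of "\<lambda>n. - w n"] by simp
  finally show ?thesis
    using norm_sum_mult_le_variation[of a b z B "\<lambda>n. of_real (w n)"] assms by simp
qed

subsection \<open>The Kusmin--Landau inequality\<close>

definition increment :: "(nat \<Rightarrow> 'a::minus) \<Rightarrow> nat \<Rightarrow> 'a" where
  "increment f n = f (Suc n) - f n"

lemma norm_one_minus_cis: "norm (1 - cis x) = 2 * \<bar>sin (x / 2)\<bar>"
  using dist_exp_i_1[of x] by (simp add: cis_conv_exp norm_minus_commute)

lemma inverse_one_minus_cis:
  assumes "sin (x / 2) \<noteq> 0"
  shows "inverse (1 - cis x) = Complex (1/2) (cot (x / 2) / 2)"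
proof (rule inverse_unique)
  define u where "u = x / 2"
  have cis_eq: "cis x = Complex (1 - 2 * (sin u * sin u)) (2 * sin u * cos u)"
    using cos_double_sin[of u] sin_double[of u] by (simp add: u_def cis.code power2_eq_square)
  show "(1 - cis x) * Complex (1/2) (cot (x / 2) / 2) = 1"
    unfolding cis_eq using assms sin_cos_squared_add[of u]
    by (simp add: complex_eq_iff cot_def power2_eq_square flip: u_def)
qed

lemma cis_eq_inverse_mult_diff:
  assumes "cis x \<noteq> 1"
  shows "cis a = inverse (1 - cis x) * (cis a - cis (a + x))"
  using assms by (simp add: field_simps flip: cis_mult)

lemma cot_antimono:
  fixes x y :: real
  assumes "0 < x" "x \<le> y" "y < pi"
  shows "cot y \<le> cot x"
proof -
  have "0 < sin x" "0 < sin y" "0 \<le> sin (y - x)"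
    using assms by (auto intro!: sin_gt_zero sin_ge_zero)
  then show ?thesis
    by (simp add: cot_def sin_diff field_simps)
qed

lemma sin_ge_sin_endpoint:
  fixes x \<eta> :: real
  assumes "0 \<le> \<eta>" "\<eta> \<le> x" "x \<le> pi - \<eta>"
  shows "sin \<eta> \<le> sin x"
proof (cases "x \<le> pi / 2")
  case True
  then show ?thesis
    using assms by (intro sin_monotone_2pi_le) auto
next
  case False
  then have "sin \<eta> \<le> sin (pi - x)"
    using assms by (intro sin_monotone_2pi_le) auto
  then show ?thesis
    by simp
qed

lemma sum_norm_inverse_one_minus_cis_diff_le:
  fixes x :: "nat \<Rightarrow> real"
  assumes "p \<le> q" and \<theta>: "0 < \<theta>"
    and range: "\<And>n. n \<in> {p..q} \<Longrightarrow> x n \<in> {\<theta>..2 * pi - \<theta>}"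
    and antimono: "\<And>n. n \<in> {p..<q} \<Longrightarrow> x (Suc n) \<le> x n"
  shows "(\<Sum>n=p..<q. norm (inverse (1 - cis (x n)) - inverse (1 - cis (x (Suc n))))) \<le> cot (\<theta> / 2)"
proof -
  have sin_pos: "0 < sin (x n / 2)" if "n \<in> {p..q}" for n
    using range[OF that] \<theta> by (intro sin_gt_zero) auto
  have variation: "norm (inverse (1 - cis (x n)) - inverse (1 - cis (x (Suc n))))
      = cot (x (Suc n) / 2) / 2 - cot (x n / 2) / 2" if n: "n \<in> {p..<q}" for n
  proof -
    have "cot (x n / 2) \<le> cot (x (Suc n) / 2)"
      using antimono[OF n] range[of n] range[of "Suc n"] n \<theta> by (intro cot_antimono) auto
    then show ?thesis
      using sin_pos[of n] sin_pos[of "Suc n"] n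
      by (simp add: inverse_one_minus_cis cmod_def flip: diff_divide_distrib)
  qed
  have "(\<Sum>n=p..<q. norm (inverse (1 - cis (x n)) - inverse (1 - cis (x (Suc n)))))
      = cot (x q / 2) / 2 - cot (x p / 2) / 2"
    using sum_Suc_diff'[OF \<open>p \<le> q\<close>, of "\<lambda>n. cot (x n / 2) / 2"] by (simp add: variation)
  moreover have "cot (x q / 2) \<le> cot (\<theta> / 2)" "cot (pi - \<theta> / 2) \<le> cot (x p / 2)"
    using range[of p] range[of q] \<open>p \<le> q\<close> \<theta> by (auto intro!: cot_antimono)
  moreover have "cot (pi - \<theta> / 2) = - cot (\<theta> / 2)"
    by (simp add: cot_def)
  ultimately show ?thesis
    by simp
qed

lemma norm_sum_cis_le_if_cis_increments:
  fixes f x :: "nat \<Rightarrow> real"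
  assumes "p \<le> q" and \<theta>: "0 < \<theta>"
    and cis_Suc: "\<And>n. n \<in> {p..q} \<Longrightarrow> cis (f (Suc n)) = cis (f n + x n)"
    and range: "\<And>n. n \<in> {p..q} \<Longrightarrow> x n \<in> {\<theta>..2 * pi - \<theta>}"
    and antimono: "\<And>n. n \<in> {p..<q} \<Longrightarrow> x (Suc n) \<le> x n"
  shows "norm (\<Sum>n=p..q. cis (f n)) \<le> 3 / sin (\<theta> / 2)"
proof -
  define w where "w n = inverse (1 - cis (x n))" for n
  define s where "s = sin (\<theta> / 2)"
  have s_pos: "0 < s"
    using range[of p] \<open>p \<le> q\<close> \<theta> unfolding s_def by (intro sin_gt_zero) auto
  have s_le: "s \<le> sin (x n / 2)" if "n \<in> {p..q}" for n
    unfolding s_def using range[OF that] \<theta> by (intro sin_ge_sin_endpoint) auto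
  have cis_eq: "cis (f n) = w n * (cis (f n) - cis (f (Suc n)))" if n: "n \<in> {p..q}" for n
  proof -
    have "cis (x n) \<noteq> 1"
      using norm_one_minus_cis[of "x n"] s_le[OF n] s_pos by auto
    then show ?thesis
      by (simp add: w_def cis_Suc[OF n] flip: cis_eq_inverse_mult_diff)
  qed
  have "norm (\<Sum>n=p..c. cis (f n) - cis (f (Suc n))) \<le> 2" if "c \<in> {p..q}" for c
    using that norm_triangle_ineq4[of "cis (f p)" "cis (f (Suc c))"]
    by (simp add: sum_natinterval_diff[of "\<lambda>n. cis (f n)", simplified])
  then have "norm (\<Sum>n=p..q. w n * (cis (f n) - cis (f (Suc n))))
      \<le> (norm (w q) + (\<Sum>n=p..<q. norm (w n - w (Suc n)))) * 2"
    by (rule norm_sum_mult_le_variation[OF \<open>p \<le> q\<close>])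
  also have "\<dots> \<le> (1 / (2 * s) + 1 / s) * 2"
  proof (intro mult_right_mono add_mono)
    show "norm (w q) \<le> 1 / (2 * s)"
      using s_le[of q] s_pos \<open>p \<le> q\<close>
      by (simp add: w_def norm_divide norm_one_minus_cis inverse_eq_divide frac_le)
    have "(\<Sum>n=p..<q. norm (w n - w (Suc n))) \<le> cot (\<theta> / 2)"
      unfolding w_def
      by (rule sum_norm_inverse_one_minus_cis_diff_le[where x = x, OF \<open>p \<le> q\<close> \<theta> range antimono])
    also have "\<dots> \<le> 1 / s"
      using s_pos by (simp add: cot_def s_def divide_right_mono)
    finally show "(\<Sum>n=p..<q. norm (w n - w (Suc n))) \<le> 1 / s" .
  qed simp
  also have "\<dots> = 3 / s"
    by (simp add: field_simps)
  finally show ?thesis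
    using cis_eq by (simp add: s_def)
qed

lemma kusmin_landau:
  fixes f :: "nat \<Rightarrow> real" and k :: int
  assumes "p \<le> q" and \<theta>: "0 < \<theta>"
    and range: "\<And>n. n \<in> {p..q} \<Longrightarrow>
      increment f n \<in> {2 * pi * of_int k + \<theta>..2 * pi * (of_int k + 1) - \<theta>}"
    and antimono: "\<And>n. n \<in> {p..<q} \<Longrightarrow> increment f (Suc n) \<le> increment f n"
  shows "norm (\<Sum>n=p..q. cis (f n)) \<le> 3 / sin (\<theta> / 2)"
proof -
  define x where "x n = increment f n - 2 * pi * of_int k" for n
  show ?thesis
  proof (rule norm_sum_cis_le_if_cis_increments[where x = x, OF \<open>p \<le> q\<close> \<theta>])
    fix n
    have "cis (f (Suc n)) = cis (f n + x n + 2 * pi * of_int k)"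
      by (simp add: x_def increment_def)
    also have "\<dots> = cis (f n + x n)"
      by (simp flip: cis_mult add: cis_multiple_2pi)
    finally show "cis (f (Suc n)) = cis (f n + x n)" .
    show "x n \<in> {\<theta>..2 * pi - \<theta>}" if "n \<in> {p..q}"
      using range[OF that] by (auto simp: x_def algebra_simps)
    show "x (Suc n) \<le> x n" if "n \<in> {p..<q}"
      using antimono[OF that] by (simp add: x_def)
  qed
qed

subsection \<open>Van der Corput's second derivative test\<close>

lemma ex_interval_eq_finite_convex_nat_set:
  fixes S :: "nat set"
  assumes "finite S" and "\<And>a b c. a \<in> S \<Longrightarrow> c \<in> S \<Longrightarrow> a \<le> b \<Longrightarrow> b \<le> c \<Longrightarrow> b \<in> S"
  shows "\<exists>a b. S = {a..b}"
proof (cases "S = {}")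
  case True
  then have "S = {1..0}"
    by simp
  then show ?thesis
    by blast
next
  case False
  have "S \<subseteq> {Min S..Max S}"
    using \<open>finite S\<close> by auto
  moreover have "{Min S..Max S} \<subseteq> S"
    using assms(2)[OF Min_in[OF \<open>finite S\<close> False] Max_in[OF \<open>finite S\<close> False]] by auto
  ultimately show ?thesis
    by blast
qed

lemma total_decrease_ge:
  fixes d :: "nat \<Rightarrow> real"
  assumes step: "\<And>n. n \<in> {p..<q} \<Longrightarrow> d (Suc n) + \<mu> \<le> d n"
    and "p \<le> a" "a \<le> b" "b \<le> q"
  shows "d b + real (b - a) * \<mu> \<le> d a"
  using assms(3,4)
proof (induction b rule: nat_induct_at_least)
  case (Suc b)
  then show ?case
    using step[of b] \<open>p \<le> a\<close> by (simp add: Suc_diff_le algebra_simps)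
qed simp

lemma antimono_if_step_antimono:
  fixes d :: "nat \<Rightarrow> real"
  assumes "\<And>n. n \<in> {p..<q} \<Longrightarrow> d (Suc n) \<le> d n" and "p \<le> a" "a \<le> b" "b \<le> q"
  shows "d b \<le> d a"
  using total_decrease_ge[of p q d 0 a b] assms by simp

lemma card_decreasing_vimage_le:
  fixes d :: "nat \<Rightarrow> real"
  assumes step: "\<And>n. n \<in> {p..<q} \<Longrightarrow> d (Suc n) + \<mu> \<le> d n" and "0 < \<mu>" and "u \<le> v"
  shows "real (card {n \<in> {p..q}. d n \<in> {u..v}}) \<le> (v - u) / \<mu> + 1"
proof -
  define S where "S = {n \<in> {p..q}. d n \<in> {u..v}}"
  have "real (card S) \<le> (v - u) / \<mu> + 1"
  proof (cases "S = {}")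
    case False
    define a b where "a = Min S" and "b = Max S"
    have "finite S"
      by (simp add: S_def)
    then have ab: "a \<in> S" "b \<in> S" "a \<le> b" and "S \<subseteq> {a..b}"
    by (auto simp: a_def b_def False)
    then have "real (card S) \<le> real (b - a) + 1"
      using card_mono[OF _ \<open>S \<subseteq> {a..b}\<close>] by simp
    moreover have "d b + real (b - a) * \<mu> \<le> d a"
      using ab by (intro total_decrease_ge[of p q d, OF step]) (auto simp: S_def)
    then have "real (b - a) * \<mu> \<le> v - u"
      using ab by (auto simp: S_def)
    then have "real (b - a) \<le> (v - u) / \<mu>"
      using \<open>0 < \<mu>\<close> by (simp add: field_simps)
    ultimately show ?thesis
      by simp
  qed (use assms in auto)
  then show ?thesis
    by (simp add: S_def)
qed

lemma card_decreasing_vimage_margin_le: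
  fixes d :: "nat \<Rightarrow> real"
  assumes step: "\<And>n. n \<in> {p..<q} \<Longrightarrow> d (Suc n) + \<mu> \<le> d n" and "0 < \<mu>" and "0 \<le> \<theta>"
  shows "real (card ({n \<in> {p..q}. d n \<in> {u..v}} - {n \<in> {p..q}. d n \<in> {u + \<theta>..v - \<theta>}}))
    \<le> 2 * (\<theta> / \<mu> + 1)"
proof -
  define level where "level I = {n \<in> {p..q}. d n \<in> I}" for I
  have "card (level {u..v} - level {u + \<theta>..v - \<theta>}) \<le> card (level {u..u + \<theta>} \<union> level {v - \<theta>..v})"
    by (intro card_mono) (auto simp: level_def)
  also have "\<dots> \<le> card (level {u..u + \<theta>}) + card (level {v - \<theta>..v})"
    by (rule card_Un_le)
  finally have "real (card (level {u..v} - level {u + \<theta>..v - \<theta>}))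
      \<le> real (card (level {u..u + \<theta>})) + real (card (level {v - \<theta>..v}))"
    by linarith
  also have "\<dots> \<le> (\<theta> / \<mu> + 1) + (\<theta> / \<mu> + 1)"
    unfolding level_def using \<open>0 \<le> \<theta>\<close>
    by (intro add_mono order_trans[OF card_decreasing_vimage_le[where d = d, OF step \<open>0 < \<mu>\<close>]]) auto
  finally show ?thesis
    by (simp add: level_def)
qed

lemma antimono_vimage_eq_interval:
  fixes d :: "nat \<Rightarrow> real"
  assumes antimono: "\<And>n. n \<in> {p..<q} \<Longrightarrow> d (Suc n) \<le> d n"
  shows "\<exists>a b. {n \<in> {p..q}. d n \<in> {u..v}} = {a..b}"
proof (rule ex_interval_eq_finite_convex_nat_set)
  note le = antimono_if_step_antimono[of p q d, OF antimono]
  fix a b c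
  assume "a \<in> {n \<in> {p..q}. d n \<in> {u..v}}" "c \<in> {n \<in> {p..q}. d n \<in> {u..v}}" "a \<le> b" "b \<le> c"
  then show "b \<in> {n \<in> {p..q}. d n \<in> {u..v}}"
    using le[of a b] le[of b c] by auto
qed simp

lemma norm_sum_cis_le_card: "norm (\<Sum>n\<in>S. cis (f n)) \<le> real (card S)"
  using sum_norm_le[of S "\<lambda>n. cis (f n)" "\<lambda>_. 1"] by simp

lemma kusmin_landau_vimage:
  fixes f :: "nat \<Rightarrow> real" and k :: int
  assumes "0 < \<theta>" "\<theta> \<le> pi"
    and antimono: "\<And>n. n \<in> {p..<q} \<Longrightarrow> increment f (Suc n) \<le> increment f n"
  shows "norm (\<Sum>n | n \<in> {p..q} \<and>
        increment f n \<in> {2 * pi * of_int k + \<theta>..2 * pi * (of_int k + 1) - \<theta>}. cis (f n))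
      \<le> 3 / sin (\<theta> / 2)"
proof -
  define S where "S = {n \<in> {p..q}.
    increment f n \<in> {2 * pi * of_int k + \<theta>..2 * pi * (of_int k + 1) - \<theta>}}"
  obtain a b where S: "S = {a..b}"
    unfolding S_def using antimono_vimage_eq_interval[of p q "increment f", OF antimono] by blast
  have "norm (\<Sum>n\<in>S. cis (f n)) \<le> 3 / sin (\<theta> / 2)"
  proof (cases "a \<le> b")
    case True
    have mem: "n \<in> S" if "n \<in> {a..b}" for n
      using that S by simp
    have "norm (\<Sum>n=a..b. cis (f n)) \<le> 3 / sin (\<theta> / 2)"
    proof (rule kusmin_landau[OF True \<open>0 < \<theta>\<close>])
      show "increment f n \<in> {2 * pi * of_int k + \<theta>..2 * pi * (of_int k + 1) - \<theta>}"
        if "n \<in> {a..b}" for n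
        using mem[OF that] by (simp add: S_def)
      show "increment f (Suc n) \<le> increment f n" if "n \<in> {a..<b}" for n
        using mem[of n] mem[of "Suc n"] that by (intro antimono) (auto simp: S_def)
    qed
    then show ?thesis
      by (simp add: S)
  qed (use assms in \<open>auto simp: S intro!: sin_ge_zero\<close>)
  then show ?thesis
    by (simp add: S_def)
qed

lemma sin_ge_half:
  fixes x :: real
  assumes "0 \<le> x" "x \<le> 1"
  shows "x / 2 \<le> sin x"
proof -
  have x: "x < pi / 3"
    using assms pi_gt3 by simp
  then have "1/2 \<le> cos x"
    using cos_monotone_0_pi_le[of x "pi / 3"] assms by (simp add: cos_60)
  moreover have "x \<le> tan x"
    using abs_tan_ge[of x] tan_gt_zero[of x] x assms by (cases "x = 0") auto
  ultimately have "x / 2 \<le> tan x * cos x"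
    using mult_mono[of x "tan x" "1/2" "cos x"] assms by simp
  then show ?thesis
    using \<open>1/2 \<le> cos x\<close> by (simp add: tan_def)
qed

text \<open>Kusmin--Landau handles the increments at distance at least \<open>\<theta>\<close> from \<open>2 * pi * \<int>\<close>; the
  remaining ones are few because they are \<open>\<mu>\<close>-separated. The choice \<open>\<theta> = sqrt \<mu>\<close> balances both.\<close>

lemma norm_sum_cis_period_le:
  fixes f :: "nat \<Rightarrow> real" and k :: int
  assumes step: "\<And>n. n \<in> {p..<q} \<Longrightarrow> increment f (Suc n) + \<mu> \<le> increment f n"
    and \<mu>: "0 < \<mu>" "\<mu> \<le> 1"
  shows "norm (\<Sum>n | n \<in> {p..q} \<and>
        increment f n \<in> {2 * pi * of_int k..<2 * pi * (of_int k + 1)}. cis (f n)) \<le> 16 / sqrt \<mu>"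
proof -
  define \<theta> where "\<theta> = sqrt \<mu>"
  have \<theta>: "0 < \<theta>" "\<theta> \<le> 1" "\<theta> / \<mu> = 1 / \<theta>"
    using \<mu> by (auto simp: \<theta>_def field_simps)
  define u v where "u = 2 * pi * of_int k" and "v = 2 * pi * (of_int k + 1)"
  define level where "level I = {n \<in> {p..q}. increment f n \<in> I}" for I
  have fin: "finite (level I)" for I
    by (simp add: level_def)
  have sub: "level {u + \<theta>..v - \<theta>} \<subseteq> level {u..<v}"
    using \<theta> by (auto simp: level_def)
  have "norm (\<Sum>n\<in>level {u + \<theta>..v - \<theta>}. cis (f n)) \<le> 3 / sin (\<theta> / 2)"
    unfolding level_def u_def v_def
  proof (rule kusmin_landau_vimage)
    show "increment f (Suc n) \<le> increment f n" if "n \<in> {p..<q}" for n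
      using step[OF that] \<mu> by simp
  qed (use \<theta> pi_gt3 in auto)
  also have "\<dots> \<le> 3 / (\<theta> / 2 / 2)"
    using sin_ge_half[of "\<theta> / 2"] \<theta> by (intro divide_left_mono mult_pos_pos) auto
  finally have middle: "norm (\<Sum>n\<in>level {u + \<theta>..v - \<theta>}. cis (f n)) \<le> 12 / \<theta>"
    by simp
  have "real (card (level {u..<v} - level {u + \<theta>..v - \<theta>}))
      \<le> real (card (level {u..v} - level {u + \<theta>..v - \<theta>}))"
    by (intro of_nat_mono card_mono Diff_mono fin finite_Diff) (auto simp: level_def)
  also have "\<dots> \<le> 2 * (\<theta> / \<mu> + 1)"
    unfolding level_def using \<theta> \<mu>
    by (intro card_decreasing_vimage_margin_le[where d = "increment f", OF step]) auto
  also have "\<dots> \<le> 4 / \<theta>"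
    using \<theta> by (simp add: field_simps)
  finally have margin: "norm (\<Sum>n\<in>level {u..<v} - level {u + \<theta>..v - \<theta>}. cis (f n)) \<le> 4 / \<theta>"
    by (rule order_trans[OF norm_sum_cis_le_card])
  have "norm (\<Sum>n\<in>level {u..<v}. cis (f n)) \<le> 4 / \<theta> + 12 / \<theta>"
    unfolding sum.subset_diff[OF sub fin]
    by (rule order_trans[OF norm_triangle_ineq add_mono[OF margin middle]])
  then show ?thesis
    by (simp add: level_def u_def v_def \<theta>_def)
qed

theorem second_derivative_test:
  fixes f :: "nat \<Rightarrow> real"
  assumes "p \<le> q"
    and step: "\<And>n. n \<in> {p..<q} \<Longrightarrow> increment f (Suc n) + \<mu> \<le> increment f n"
    and \<mu>: "0 < \<mu>" "\<mu> \<le> 1"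
  shows "norm (\<Sum>n=p..q. cis (f n)) \<le> 16 * (increment f p - increment f q + 2) / sqrt \<mu>"
proof -
  define period where "period n = \<lfloor>increment f n / (2 * pi)\<rfloor>" for n
  have antimono: "increment f b \<le> increment f a" if "p \<le> a" "a \<le> b" "b \<le> q" for a b
  proof (rule antimono_if_step_antimono[of p q "increment f"])
    show "increment f (Suc n) \<le> increment f n" if "n \<in> {p..<q}" for n
      using step[OF that] \<mu> by simp
  qed (use that in auto)
  have period_range: "period ` {p..q} \<subseteq> {period q..period p}"
    using antimono by (auto simp: period_def intro!: floor_mono divide_right_mono)
  have "(\<Sum>n=p..q. cis (f n))
      = (\<Sum>k\<in>{period q..period p}. \<Sum>n | n \<in> {p..q} \<and> period n = k. cis (f n))"
    using period_range by (intro sum.group[symmetric]) auto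
  moreover have "period n = k \<longleftrightarrow> increment f n \<in> {2 * pi * of_int k..<2 * pi * (of_int k + 1)}" for n k
    by (simp add: period_def floor_eq_iff field_simps)
  ultimately have "norm (\<Sum>n=p..q. cis (f n)) \<le> (\<Sum>k\<in>{period q..period p}. 16 / sqrt \<mu>)"
    by (simp only:) (intro sum_norm_le norm_sum_cis_period_le step \<mu>)
  also have "\<dots> = of_int (period p - period q + 1) * (16 / sqrt \<mu>)"
    using period_range \<open>p \<le> q\<close> by auto
  also have "\<dots> \<le> (increment f p - increment f q + 2) * (16 / sqrt \<mu>)"
  proof (rule mult_right_mono)
    have "of_int (period p - period q + 1) \<le> (increment f p - increment f q) / (2 * pi) + 2"
      unfolding period_def diff_divide_distrib by linarith
    also have "(increment f p - increment f q) / (2 * pi) \<le> (increment f p - increment f q) / 1"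
      using antimono[of p q] \<open>p \<le> q\<close> pi_gt3 by (intro divide_left_mono) auto
    finally show "of_int (period p - period q + 1) \<le> increment f p - increment f q + 2"
      by simp
  qed (use \<mu> in auto)
  finally show ?thesis
    by (simp add: mult.commute)
qed

subsection \<open>Sums of complex powers\<close>

lemma increment_ln_le:
  assumes "0 < n"
  shows "increment (\<lambda>n. ln (real n)) n \<le> 1 / real n"
  using ln_diff_le[of "real (Suc n)" "real n"] assms by (simp add: increment_def)

lemma increment_ln_decrease_ge:
  assumes "0 < n"
  shows "increment (\<lambda>n. ln (real n)) (Suc n) + 1 / (real (Suc n))\<^sup>2 \<le> increment (\<lambda>n. ln (real n)) n"
proof -
  define x where "x = real n * (real n + 2) / (real n + 1)\<^sup>2"
  have pos: "0 < x"
    using assms by (simp add: x_def)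
  have "ln x = ln n + ln (Suc (Suc n)) - 2 * ln (Suc n)"
    using assms by (simp add: x_def ln_div ln_mult ln_realpow add.commute)
  moreover have "ln x \<le> x - 1"
    by (rule ln_le_minus_one[OF pos])
  moreover have "x - 1 = - (1 / (real (Suc n))\<^sup>2)"
    by (simp add: x_def divide_simps power2_eq_square) (simp add: algebra_simps)
  ultimately show ?thesis
    by (simp add: increment_def)
qed

lemma increment_mult_left: "increment (\<lambda>n. c * f n) n = (c :: 'a::ring) * increment f n"
  by (simp add: increment_def right_diff_distrib)

lemma norm_sum_cis_ln_le:
  fixes a b :: nat and t :: real
  assumes "0 < t" "0 < a" "sqrt t \<le> 3 * real a" "a < b" "b \<le> 2 * a"
  shows "norm (\<Sum>n=Suc a..b. cis (t * ln (real n))) \<le> 48 * (sqrt t + 2 * real a / sqrt t)"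
proof -
  let ?f = "\<lambda>n. t * ln (real n)"
  define \<mu> where "\<mu> = t / (3 * real a)\<^sup>2"
  have sqrt_\<mu>: "sqrt \<mu> = sqrt t / (3 * real a)"
    unfolding \<mu>_def real_sqrt_divide real_sqrt_abs by simp
  have \<mu>: "0 < \<mu>" "\<mu> \<le> 1"
    using assms real_sqrt_le_1_iff[of \<mu>] by (simp_all add: sqrt_\<mu>) (simp add: \<mu>_def)
  have "norm (\<Sum>n=Suc a..b. cis (?f n))
      \<le> 16 * (increment ?f (Suc a) - increment ?f b + 2) / sqrt \<mu>"
  proof (rule second_derivative_test[OF _ _ \<mu>])
    fix n assume n: "n \<in> {Suc a..<b}"
    have "\<mu> \<le> t / (real (Suc n))\<^sup>2"
      unfolding \<mu>_def using n assms by (intro divide_left_mono power_mono) auto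
    also have "\<dots> = t * (1 / (real (Suc n))\<^sup>2)"
      by simp
    finally show "increment ?f (Suc n) + \<mu> \<le> increment ?f n"
      using mult_left_mono[OF increment_ln_decrease_ge[of n], of t] n \<open>0 < t\<close>
      by (simp only: increment_mult_left distrib_left) simp
  qed (use \<open>a < b\<close> in auto)
  also have "\<dots> \<le> 16 * (t / a + 2) / sqrt \<mu>"
  proof -
    have "increment ?f (Suc a) \<le> t * (1 / Suc a)"
      unfolding increment_mult_left using \<open>0 < t\<close> by (intro mult_left_mono increment_ln_le) auto
    also have "\<dots> \<le> t * (1 / a)"
      using assms by (intro mult_left_mono divide_left_mono) auto
    finally have "increment ?f (Suc a) \<le> t / a"
      by simp
    moreover have "0 \<le> increment ?f b"
      using assms by (simp add: increment_def)
    ultimately show ?thesis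
      using \<mu> by (intro divide_right_mono) auto
  qed
  also have "\<dots> = 48 * (t / sqrt t + 2 * real a / sqrt t)"
    using \<open>0 < a\<close> \<open>0 < t\<close> by (simp add: sqrt_\<mu> field_simps)
  also have "t / sqrt t = sqrt t"
    by (rule real_div_sqrt) (use \<open>0 < t\<close> in simp)
  finally show ?thesis .
qed

lemma norm_sum_cis_ln_block_le:
  fixes a b :: nat and t :: real
  assumes t: "1 \<le> t" and a: "0 < a" "real a \<le> 2 * t" and b: "b \<le> 2 * a"
  shows "norm (\<Sum>n=Suc a..b. cis (t * ln (real n))) \<le> 240 * sqrt t"
proof (cases "real a \<le> sqrt t \<or> b \<le> a")
  case True
  have "norm (\<Sum>n=Suc a..b. cis (t * ln (real n))) \<le> real (card {Suc a..b})"
    by (rule norm_sum_cis_le_card)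
  also have "\<dots> \<le> 240 * sqrt t"
    using True b t by auto
  finally show ?thesis .
next
  case False
  then have "norm (\<Sum>n=Suc a..b. cis (t * ln (real n))) \<le> 48 * (sqrt t + 2 * real a / sqrt t)"
    using t a b by (intro norm_sum_cis_ln_le) auto
  also have "2 * real a / sqrt t \<le> 4 * (t / sqrt t)"
    using a t by (simp add: divide_right_mono)
  also have "t / sqrt t = sqrt t"
    by (rule real_div_sqrt) (use t in simp)
  finally show ?thesis
    by simp
qed

lemma of_nat_powr_Complex:
  assumes "0 < n"
  shows "of_nat n powr Complex \<sigma> t = of_real (real n powr \<sigma>) * cis (t * ln (real n))"
proof -
  have "of_nat n powr Complex \<sigma> t = exp (Complex \<sigma> t * of_real (ln (real n)))"
    using assms by (simp add: powr_def Ln_of_nat)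
  also have "\<dots> = of_real (exp (\<sigma> * ln (real n))) * cis (t * ln (real n))"
    by (subst exp_eq_polar) simp
  finally show ?thesis
    using assms by (simp add: powr_def)
qed

lemma norm_sum_nat_powr_block_le:
  fixes a b :: nat and t \<sigma> :: real
  assumes "1 \<le> t" "0 \<le> \<sigma>" "0 < a" "real a \<le> 2 * t" "b \<le> 2 * a"
  shows "norm (\<Sum>n=Suc a..b. of_nat n powr Complex (- \<sigma>) t) \<le> 240 * sqrt t * real a powr - \<sigma>"
proof (cases "Suc a \<le> b")
  case True
  have "norm (\<Sum>n=Suc a..b. of_nat n powr Complex (- \<sigma>) t)
      = norm (\<Sum>n=Suc a..b. of_real (real n powr - \<sigma>) * cis (t * ln (real n)))"
    by (simp add: of_nat_powr_Complex)
  also have "\<dots> \<le> real (Suc a) powr - \<sigma> * (240 * sqrt t)"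
  proof (rule norm_sum_antimono_weights_le[OF True])
    show "norm (\<Sum>n=Suc a..c. cis (t * ln (real n))) \<le> 240 * sqrt t" if "c \<in> {Suc a..b}" for c
      using assms that by (intro norm_sum_cis_ln_block_le) auto
    show "real (Suc n) powr - \<sigma> \<le> real n powr - \<sigma>" if "n \<in> {Suc a..<b}" for n
      using that \<open>0 \<le> \<sigma>\<close> by (intro powr_mono2') auto
  qed simp
  also have "\<dots> \<le> real a powr - \<sigma> * (240 * sqrt t)"
    using assms by (intro mult_right_mono powr_mono2') auto
  finally show ?thesis
    by (simp add: mult.commute)
qed (use \<open>1 \<le> t\<close> in auto)

lemma norm_sum_le_of_dyadic_blocks:
  fixes f :: "nat \<Rightarrow> 'a::real_normed_vector"
  assumes "0 < \<sigma>" "0 \<le> C"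
    and block: "\<And>a b. 0 < a \<Longrightarrow> a \<le> b \<Longrightarrow> b \<le> 2 * a \<Longrightarrow> b \<le> N \<Longrightarrow>
      norm (\<Sum>n=Suc a..b. f n) \<le> C * real a powr - \<sigma>"
    and "0 < a"
  shows "norm (\<Sum>n=Suc a..N. f n) \<le> C / (1 - 2 powr - \<sigma>) * real a powr - \<sigma>"
  using \<open>0 < a\<close>
proof (induction "N - a" arbitrary: a rule: less_induct)
  case less
  define r where "r = 2 powr - \<sigma>"
  have r: "0 < r" "r < 1"
    using \<open>0 < \<sigma>\<close> by (auto simp: r_def powr_less_one)
  define K where "K = C / (1 - r)"
  have K: "C + K * r = K" "C \<le> K"
    using r \<open>0 \<le> C\<close> by (auto simp: K_def field_simps)
  consider "N < a" | "a \<le> N" "N \<le> 2 * a" | "2 * a < N"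
    by linarith
  then have "norm (\<Sum>n=Suc a..N. f n) \<le> K * real a powr - \<sigma>"
  proof cases
    case 1
    then show ?thesis
      using K \<open>0 \<le> C\<close> by simp
  next
    case 2
    then have "norm (\<Sum>n=Suc a..N. f n) \<le> C * real a powr - \<sigma>"
      using less.prems by (intro block) auto
    also have "\<dots> \<le> K * real a powr - \<sigma>"
      using K by (intro mult_right_mono) auto
    finally show ?thesis .
  next
    case 3
    then have "(\<Sum>n=Suc a..N. f n) = (\<Sum>n=Suc a..2*a. f n) + (\<Sum>n=Suc (2*a)..N. f n)"
      using sum.ub_add_nat[of "Suc a" "2*a" f "N - 2*a"] less.prems by simp
    also have "norm \<dots> \<le> C * real a powr - \<sigma> + K * real (2 * a) powr - \<sigma>"
      unfolding K_def r_def using less.prems 3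
      by (intro norm_triangle_mono block less.hyps) auto
    also have "\<dots> = (C + K * r) * real a powr - \<sigma>"
      by (simp add: powr_mult r_def algebra_simps)
    finally show ?thesis
      by (simp only: K)
  qed
  then show ?case
    by (simp add: K_def r_def)
qed

definition nat_powr_sum_const :: "real \<Rightarrow> real" where
  "nat_powr_sum_const \<sigma> = 240 * 2 powr \<sigma> / (1 - 2 powr - \<sigma>)"

lemma norm_sum_nat_powr_le:
  fixes b :: nat and t \<sigma> x :: real
  assumes "1 \<le> t" "0 < \<sigma>" "1 \<le> x" "real b \<le> 2 * t"
  shows "norm (\<Sum>n=Suc (nat \<lfloor>x\<rfloor>)..b. of_nat n powr Complex (- \<sigma>) t)
    \<le> nat_powr_sum_const \<sigma> * sqrt t * x powr - \<sigma>"
proof -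
  define a where "a = nat \<lfloor>x\<rfloor>"
  have "1 \<le> \<lfloor>x\<rfloor>"
    using \<open>1 \<le> x\<close> by simp
  then have a: "0 < a" "x / 2 \<le> real a"
    unfolding a_def by linarith+
  have "real a powr - \<sigma> \<le> (x / 2) powr - \<sigma>"
    using a assms by (intro powr_mono2') auto
  also have "\<dots> = 2 powr \<sigma> * x powr - \<sigma>"
    using assms by (simp add: powr_divide powr_minus field_simps)
  finally have powr_le: "real a powr - \<sigma> \<le> 2 powr \<sigma> * x powr - \<sigma>" .
  have "norm (\<Sum>n=Suc a..b. of_nat n powr Complex (- \<sigma>) t)
      \<le> 240 * sqrt t / (1 - 2 powr - \<sigma>) * real a powr - \<sigma>"
    using assms a by (intro norm_sum_le_of_dyadic_blocks norm_sum_nat_powr_block_le) auto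
  also have "\<dots> \<le> 240 * sqrt t / (1 - 2 powr - \<sigma>) * (2 powr \<sigma> * x powr - \<sigma>)"
    using powr_less_one[of 2 "- \<sigma>"] assms by (intro mult_left_mono powr_le) auto
  finally show ?thesis
    by (simp add: a_def nat_powr_sum_const_def mult_ac)
qed

lemma sum_nat_floor_le_antiderivative:
  fixes f F :: "real \<Rightarrow> real"
  assumes deriv: "\<And>x. 1 \<le> x \<Longrightarrow> (F has_real_derivative f x) (at x)"
    and antimono: "\<And>x y. 1 \<le> x \<Longrightarrow> x \<le> y \<Longrightarrow> f y \<le> f x"
    and nonneg: "\<And>x. 1 \<le> x \<Longrightarrow> 0 \<le> f x"
    and "1 \<le> x"
  shows "(\<Sum>m=1..nat \<lfloor>x\<rfloor>. f (real m)) \<le> f 1 + F x - F 1"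
proof -
  have sum_le: "(\<Sum>m=1..M. f (real m)) \<le> f 1 + F (real M) - F 1" if "1 \<le> M" for M :: nat
    using that
  proof (induction M rule: nat_induct_at_least)
    case (Suc M)
    obtain z where z: "real M < z" "z < real (Suc M)" "F (real (Suc M)) - F (real M) = f z"
      using MVT2[of "real M" "real (Suc M)" F f] deriv Suc.hyps by auto
    have "f (real (Suc M)) \<le> f z"
      using z Suc.hyps by (intro antimono) auto
    then show ?case
      using Suc.IH z by simp
  qed simp
  have "(\<Sum>m=1..nat \<lfloor>x\<rfloor>. f (real m)) \<le> f 1 + F (real (nat \<lfloor>x\<rfloor>)) - F 1"
    by (rule sum_le) (use \<open>1 \<le> x\<close> in linarith)
  also have "F (real (nat \<lfloor>x\<rfloor>)) \<le> F x"
  proof (rule DERIV_nonneg_imp_nondecreasing[where f = F])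
    fix u assume "real (nat \<lfloor>x\<rfloor>) \<le> u"
    moreover have "1 \<le> real (nat \<lfloor>x\<rfloor>)"
      using \<open>1 \<le> x\<close> by simp
    ultimately have "1 \<le> u"
      by linarith
    then show "\<exists>y. (F has_real_derivative y) (at u) \<and> 0 \<le> y"
      using deriv nonneg by blast
  qed (use \<open>1 \<le> x\<close> in simp)
  finally show ?thesis
    by simp
qed

lemma sum_powr_bigo:
  fixes \<alpha> :: real
  assumes "0 \<le> \<alpha>" "\<alpha> \<noteq> 1"
  shows "(\<lambda>x. \<Sum>m=1..nat \<lfloor>x\<rfloor>. real m powr - \<alpha>) \<in> O[at_top](\<lambda>x. x powr (1 - \<alpha>) + 1)"
proof (rule landau_o.big.trans)
  let ?F = "\<lambda>x. x powr (1 - \<alpha>) / (1 - \<alpha>)"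
  have "(\<Sum>m=1..nat \<lfloor>x\<rfloor>. real m powr - \<alpha>) \<le> 1 powr - \<alpha> + ?F x - ?F 1" if "1 \<le> x" for x
  proof (rule sum_nat_floor_le_antiderivative[OF _ _ _ that])
    show "(?F has_real_derivative y powr - \<alpha>) (at y)" if "1 \<le> y" for y
      using that \<open>\<alpha> \<noteq> 1\<close> by (auto intro!: derivative_eq_intros simp: divide_simps)
    show "y powr - \<alpha> \<le> x powr - \<alpha>" if "1 \<le> x" "x \<le> y" for x y
      using that \<open>0 \<le> \<alpha>\<close> by (intro powr_mono2') auto
  qed simp
  then show "(\<lambda>x. \<Sum>m=1..nat \<lfloor>x\<rfloor>. real m powr - \<alpha>) \<in> O[at_top](\<lambda>x. 1 + ?F x - ?F 1)"
    by (intro landau_o.big_mono eventually_at_top_linorderI[of 1])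
       (auto simp: sum_nonneg order_trans[OF _ abs_ge_self])
  show "(\<lambda>x. 1 + ?F x - ?F 1) \<in> O[at_top](\<lambda>x. x powr (1 - \<alpha>) + 1)"
    using \<open>\<alpha> \<noteq> 1\<close> by (cases "\<alpha> < 1") real_asymp+
qed

lemma sum_inverse_bigo: "(\<lambda>x. \<Sum>m=1..nat \<lfloor>x\<rfloor>. real m powr - 1) \<in> O[at_top](\<lambda>x. ln x)"
proof (rule landau_o.big.trans)
  have "(\<Sum>m=1..nat \<lfloor>x\<rfloor>. real m powr - 1) \<le> 1 powr - 1 + ln x - ln 1" if "1 \<le> x" for x
  proof (rule sum_nat_floor_le_antiderivative[OF _ _ _ that])
    show "(ln has_real_derivative y powr - 1) (at y)" if "1 \<le> y" for y :: real
      using that by (auto intro!: derivative_eq_intros simp: powr_minus divide_simps)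
    show "y powr - 1 \<le> x powr - 1" if "1 \<le> x" "x \<le> y" for x y :: real
      using that by (intro powr_mono2') auto
  qed simp
  then show "(\<lambda>x. \<Sum>m=1..nat \<lfloor>x\<rfloor>. real m powr - 1) \<in> O[at_top](\<lambda>x. 1 + ln x)"
    by (intro landau_o.big_mono eventually_at_top_linorderI[of 1])
       (auto simp: sum_nonneg order_trans[OF _ abs_ge_self])
  show "(\<lambda>x::real. 1 + ln x) \<in> O[at_top](\<lambda>x. ln x)"
    by real_asymp
qed

subsection \<open>The double sum\<close>

lemma S1_eq_sum_powr:
  "S1 \<sigma> t \<delta> = (\<Sum>m=1..nat \<lfloor>t powr \<delta>\<rfloor>. of_nat m powr Complex (- \<sigma>) (- t) *
    (\<Sum>n=Suc (nat \<lfloor>t powr (1 - \<delta>) * real m\<rfloor>)..nat \<lfloor>t\<rfloor> + m. of_nat n powr Complex (- \<sigma>) t))"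
proof -
  have "- Complex \<sigma> t = Complex (- \<sigma>) (- t)" "- cnj (Complex \<sigma> t) = Complex (- \<sigma>) t"
    by (simp_all add: complex_eq_iff)
  then have "1 / (of_nat m powr Complex \<sigma> t * of_nat n powr cnj (Complex \<sigma> t))
      = of_nat m powr Complex (- \<sigma>) (- t) * of_nat n powr Complex (- \<sigma>) t" for m n :: nat
    by (metis powr_minus inverse_mult_distrib inverse_eq_divide)
  then show ?thesis
    by (simp add: S1_def sum_distrib_left)
qed

lemma norm_S1_le:
  fixes \<sigma> \<delta> t :: real
  assumes "\<delta> \<le> 1" "0 < \<sigma>" "1 \<le> t"
  shows "norm (S1 \<sigma> t \<delta>) \<le> nat_powr_sum_const \<sigma> *
    (t powr (1/2 - \<sigma> + \<sigma> * \<delta>) * (\<Sum>m=1..nat \<lfloor>t powr \<delta>\<rfloor>. real m powr - (2 * \<sigma>)))"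
proof -
  let ?K = "nat_powr_sum_const \<sigma>"
  have "norm (of_nat m powr Complex (- \<sigma>) (- t) *
      (\<Sum>n=Suc (nat \<lfloor>t powr (1 - \<delta>) * real m\<rfloor>)..nat \<lfloor>t\<rfloor> + m. of_nat n powr Complex (- \<sigma>) t))
      \<le> ?K * t powr (1/2 - \<sigma> + \<sigma> * \<delta>) * real m powr - (2 * \<sigma>)"
    (is "norm (_ * ?inner) \<le> _") if m: "m \<in> {1..nat \<lfloor>t powr \<delta>\<rfloor>}" for m
  proof -
    have "real m \<le> t powr \<delta>"
      using m by simp linarith
    also have "\<dots> \<le> t"
      using powr_mono[of \<delta> 1 t] assms by simp
    finally have "real (nat \<lfloor>t\<rfloor> + m) \<le> 2 * t"
      using \<open>1 \<le> t\<close> by simp linarith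
    moreover have "1 \<le> t powr (1 - \<delta>) * real m"
      using m assms ge_one_powr_ge_zero[of t "1 - \<delta>"] mult_mono[of 1 "t powr (1 - \<delta>)" 1 "real m"]
      by simp
    ultimately have "norm ?inner \<le> ?K * sqrt t * (t powr (1 - \<delta>) * real m) powr - \<sigma>"
      using assms by (intro norm_sum_nat_powr_le) auto
    then have "real m powr - \<sigma> * norm ?inner
        \<le> real m powr - \<sigma> * (?K * sqrt t * (t powr (1 - \<delta>) * real m) powr - \<sigma>)"
      by (intro mult_left_mono) auto
    also have "\<dots> = ?K * (t powr (1/2) * t powr ((1 - \<delta>) * - \<sigma>)) * (real m powr - \<sigma> * real m powr - \<sigma>)"
      using \<open>1 \<le> t\<close> by (simp add: powr_half_sqrt powr_mult powr_powr)
    also have "\<dots> = ?K * t powr (1/2 - \<sigma> + \<sigma> * \<delta>) * real m powr - (2 * \<sigma>)"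
      by (simp only: powr_add[symmetric]) (simp add: algebra_simps)
    finally show ?thesis
      by (simp add: norm_mult norm_powr_real_powr)
  qed
  then have "norm (S1 \<sigma> t \<delta>)
      \<le> (\<Sum>m=1..nat \<lfloor>t powr \<delta>\<rfloor>. ?K * t powr (1/2 - \<sigma> + \<sigma> * \<delta>) * real m powr - (2 * \<sigma>))"
    unfolding S1_eq_sum_powr by (rule sum_norm_le)
  then show ?thesis
    by (simp add: sum_distrib_left mult.assoc)
qed

lemma S1_bigo:
  fixes \<sigma> \<delta> :: real
  assumes "0 < \<delta>" "\<delta> \<le> 1" "0 < \<sigma>"
    and sum_bigo: "(\<lambda>x. \<Sum>m=1..nat \<lfloor>x\<rfloor>. real m powr - (2 * \<sigma>)) \<in> O[at_top](g)"
  shows "(\<lambda>t. S1 \<sigma> t \<delta>) \<in> O[at_top](\<lambda>t. of_real (t powr (1/2 - \<sigma> + \<sigma> * \<delta>) * g (t powr \<delta>)))"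
proof (rule landau_o.big.trans)
  show "(\<lambda>t. S1 \<sigma> t \<delta>) \<in> O[at_top](\<lambda>t. of_real (t powr (1/2 - \<sigma> + \<sigma> * \<delta>) *
      (\<Sum>m=1..nat \<lfloor>t powr \<delta>\<rfloor>. real m powr - (2 * \<sigma>))))"
  proof (intro bigoI eventually_at_top_linorderI[of 1])
    fix t :: real assume "1 \<le> t"
    then show "norm (S1 \<sigma> t \<delta>) \<le> nat_powr_sum_const \<sigma> *
        norm (of_real (t powr (1/2 - \<sigma> + \<sigma> * \<delta>) *
          (\<Sum>m=1..nat \<lfloor>t powr \<delta>\<rfloor>. real m powr - (2 * \<sigma>))) :: complex)"
      unfolding norm_of_real using norm_S1_le[OF assms(2,3)] by (simp add: abs_mult sum_nonneg)
  qed
  have "filterlim (\<lambda>t. t powr \<delta>) at_top at_top"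
    using \<open>0 < \<delta>\<close> by real_asymp
  then have "(\<lambda>t. \<Sum>m=1..nat \<lfloor>t powr \<delta>\<rfloor>. real m powr - (2 * \<sigma>)) \<in> O[at_top](\<lambda>t. g (t powr \<delta>))"
    by (rule landau_o.big.compose[OF sum_bigo])
  then show "(\<lambda>t. of_real (t powr (1/2 - \<sigma> + \<sigma> * \<delta>) *
      (\<Sum>m=1..nat \<lfloor>t powr \<delta>\<rfloor>. real m powr - (2 * \<sigma>))) :: complex)
      \<in> O[at_top](\<lambda>t. of_real (t powr (1/2 - \<sigma> + \<sigma> * \<delta>) * g (t powr \<delta>)))"
    unfolding landau_o.big.of_real_iff by (intro landau_o.big.mult_left)
qed

lemma S1_bigo_if_ne_half:
  fixes \<sigma> \<delta> :: real
  assumes "0 < \<delta>" "\<delta> \<le> 1" "0 < \<sigma>" "\<sigma> \<noteq> 1/2"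
  shows "(\<lambda>t. S1 \<sigma> t \<delta>) \<in> O[at_top](\<lambda>t. of_real
    (t powr (1/2 - \<sigma>) * (t powr ((1 - \<sigma>) * \<delta>) + t powr (\<sigma> * \<delta>))))"
proof -
  have "t powr (1/2 - \<sigma> + \<sigma> * \<delta>) * ((t powr \<delta>) powr (1 - 2 * \<sigma>) + 1)
      = t powr (1/2 - \<sigma>) * (t powr ((1 - \<sigma>) * \<delta>) + t powr (\<sigma> * \<delta>))" for t
  proof -
    have "(1 - \<sigma>) * \<delta> = \<sigma> * \<delta> + \<delta> * (1 - 2 * \<sigma>)"
      by (simp add: algebra_simps)
    then show ?thesis
      by (simp only: powr_powr powr_add) (simp add: distrib_left)
  qed
  moreover have "(\<lambda>x. \<Sum>m=1..nat \<lfloor>x\<rfloor>. real m powr - (2 * \<sigma>)) \<in> O[at_top](\<lambda>x. x powr (1 - 2 * \<sigma>) + 1)"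
    using assms by (intro sum_powr_bigo) auto
  ultimately show ?thesis
    using S1_bigo[OF assms(1-3), of "\<lambda>x. x powr (1 - 2 * \<sigma>) + 1"] by (simp only:)
qed

lemma S1_half_bigo:
  fixes \<delta> :: real
  assumes "0 < \<delta>" "\<delta> \<le> 1"
  shows "(\<lambda>t. S1 (1/2) t \<delta>) \<in> O[at_top](\<lambda>t. of_real (t powr (\<delta> / 2) * ln t))"
proof -
  have "ln (t powr \<delta>) = \<delta> * ln t" for t :: real
    by (cases "t = 0") (simp_all add: ln_powr)
  then show ?thesis
    using S1_bigo[of \<delta> "1/2" ln] sum_inverse_bigo assms
    by (simp add: mult.left_commute[of _ "complex_of_real \<delta>"])
qed

theorem theorem5p1:
  fixes \<sigma> \<delta> :: real
  assumes "0 < \<delta>" "\<delta> < 1" "0 < \<sigma>" "\<sigma> < 1"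
  shows "(\<sigma> \<noteq> 1/2 \<longrightarrow>
           (\<exists>E1 E2 :: real \<Rightarrow> complex.
              E1 \<in> O[at_top](\<lambda>t. of_real
                (t powr (1/2 - \<sigma>) * (t powr ((1 - \<sigma>) * \<delta>) + t powr (\<sigma> * \<delta>)))) \<and>
              E2 \<in> O[at_top](\<lambda>t. of_real (t powr ((1 - \<sigma>) * \<delta>) / t powr \<sigma>)) \<and>
              (\<forall>t>0. S1 \<sigma> t \<delta> = E1 t + E2 t))) \<and>
         (\<sigma> = 1/2 \<longrightarrow>
           (\<exists>E1 E2 :: real \<Rightarrow> complex.
              E1 \<in> O[at_top](\<lambda>t. of_real (t powr (\<delta> / 2) * ln t)) \<and>
              E2 \<in> O[at_top](\<lambda>t. of_real (t powr (\<delta> / 2) / t powr (1/2))) \<and>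
              (\<forall>t>0. S1 (1/2) t \<delta> = E1 t + E2 t)))"
proof (intro conjI impI)
  assume "\<sigma> \<noteq> 1/2"
  show "\<exists>E1 E2 :: real \<Rightarrow> complex.
      E1 \<in> O[at_top](\<lambda>t. of_real
        (t powr (1/2 - \<sigma>) * (t powr ((1 - \<sigma>) * \<delta>) + t powr (\<sigma> * \<delta>)))) \<and>
      E2 \<in> O[at_top](\<lambda>t. of_real (t powr ((1 - \<sigma>) * \<delta>) / t powr \<sigma>)) \<and>
      (\<forall>t>0. S1 \<sigma> t \<delta> = E1 t + E2 t)"
    using S1_bigo_if_ne_half[OF assms(1) less_imp_le[OF assms(2)] assms(3) \<open>\<sigma> \<noteq> 1/2\<close>]
    by (intro exI[of _ "\<lambda>t. S1 \<sigma> t \<delta>"] exI[of _ "\<lambda>_. 0"]) simp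
next
  show "\<exists>E1 E2 :: real \<Rightarrow> complex.
      E1 \<in> O[at_top](\<lambda>t. of_real (t powr (\<delta> / 2) * ln t)) \<and>
      E2 \<in> O[at_top](\<lambda>t. of_real (t powr (\<delta> / 2) / t powr (1/2))) \<and>
      (\<forall>t>0. S1 (1/2) t \<delta> = E1 t + E2 t)"
    using S1_half_bigo[OF assms(1) less_imp_le[OF assms(2)]]
    by (intro exI[of _ "\<lambda>t. S1 (1/2) t \<delta>"] exI[of _ "\<lambda>_. 0"]) simp
qed

end
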